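(* Let $\alpha\in(0,1)$ be fixed. For all $\beta\in(0,1)$, the interval $I_n^{cx}(\alpha,\beta)$ defined by $$I_n^{cx}(\alpha,\beta)=\left[\,1-\int_{\mathbb{X}}\min\left(1,\frac{1-p_n(\mathbf{x})}{\alpha\beta}\right)P_{\mathbf{X}}(d\mathbf{x})\ ,\ \int_{\mathbb{X}}\min\left(1,\frac{p_n(\mathbf{x})}{\alpha(1-\beta)}\right)P_{\mathbf{X}}(d\mathbf{x})\right]$$ satisfies $$\mathbb{P}\big(S_n\in I_n^{cx}(\alpha,\beta)\big)\geq 1-\alpha,\qquad\forall\beta\in(0,1).$$
   Context: Let $d\geq 1$, let $\mathbb{X}\subset\mathbb{R}^d$ be measurable, let $P_{\mathbf{X}}$ be a probability distribution on $\mathbb{X}$, and let $T\in\mathbb{R}$. Let $\xi_n=(\xi_n(\mathbf{x}))_{\mathbf{x}\in\mathbb{X}}$ be a real-valued random process indexed by $\mathbb{X}$, jointly measurable in $(\omega,\mathbf{x})$. (In the paper, $\xi_n$ has the finite-dimensional laws of a prior process $\xi$, typically Gaussian, conditioned on its observed values at $n$ design points; the results are stated to be valid for any prior distribution of the process.) For $\mathbf{x}\in\mathbb{X}$ put $p_n(\mathbf{x})=\mathbb{P}(\xi_n(\mathbf{x})>T)$, and define $$S_n=\int_{\mathbb{X}}\mathbf{1}_{\xi_n(\mathbf{x})>T}\,P_{\mathbf{X}}(d\mathbf{x}).$$ *)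

theory Defs
  imports "HOL-Probability.Probability"
begin

text \<open>
  \<open>M\<close> is the underlying probability space, \<open>PX\<close> the distribution on the
  index set (so \<open>space PX\<close> is the index set and integrals over it need no explicit domain),
  \<open>\<xi> x \<omega>\<close> is the value of the process at index \<open>x\<close> and outcome \<open>\<omega>\<close>.
\<close>

definition excursion_prob :: "'w measure \<Rightarrow> ('x \<Rightarrow> 'w \<Rightarrow> real) \<Rightarrow> real \<Rightarrow> 'x \<Rightarrow> real" where
  "excursion_prob M \<xi> T x = \<P>(\<omega> in M. \<xi> x \<omega> > T)"

definition excursion_volume :: "'x measure \<Rightarrow> ('x \<Rightarrow> 'w \<Rightarrow> real) \<Rightarrow> real \<Rightarrow> 'w \<Rightarrow> real" where
  "excursion_volume PX \<xi> T \<omega> = (\<integral>x. indicator {y. \<xi> y \<omega> > T} x \<partial>PX)"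

definition cx_interval ::
  "'w measure \<Rightarrow> 'x measure \<Rightarrow> ('x \<Rightarrow> 'w \<Rightarrow> real) \<Rightarrow> real \<Rightarrow> real \<Rightarrow> real \<Rightarrow> real set" where
  "cx_interval M PX \<xi> T \<alpha> \<beta> =
    {1 - (\<integral>x. min 1 ((1 - excursion_prob M \<xi> T x) / (\<alpha> * \<beta>)) \<partial>PX) ..
     (\<integral>x. min 1 (excursion_prob M \<xi> T x / (\<alpha> * (1 - \<beta>))) \<partial>PX)}"

end

theory Submission
  imports Defs
begin

text \<open>
  Write \<open>S\<close> for the random volume of a random set with covering function \<open>p\<close>, and let
  \<open>u = \<integral> min 1 (p / \<gamma>)\<close>. On the event \<open>E = {S > u}\<close> the average of \<open>S\<close> exceeds \<open>u\<close>. On the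
  other hand, Fubini writes the integral of \<open>S\<close> over \<open>E\<close> as the spatial integral of the
  probability that \<open>x\<close> is covered and \<open>E\<close> occurs, and that probability is at most the minimum of
  \<open>p x\<close> and the probability of \<open>E\<close>. If \<open>E\<close> had probability \<open>q > \<gamma>\<close>, the average of \<open>S\<close> over \<open>E\<close>
  would thus be at most \<open>\<integral> min 1 (p / q) \<le> u\<close>, a contradiction. Hence \<open>E\<close> has probability at
  most \<open>\<gamma>\<close> (\<open>prob_section_volume_gt_le\<close>).

  Applied to the excursion set with \<open>\<gamma> = \<alpha> * (1 - \<beta>)\<close>, this bounds the probability that the
  volume exceeds the upper end of the interval; applied to its complement, whose volume is one
  minus that of the excursion set, with \<open>\<gamma> = \<alpha> * \<beta>\<close>, it bounds the probability of falling below
  the lower end. The two levels add up to \<open>\<alpha>\<close>.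
\<close>

context pair_prob_space
begin

lemma borel_measurable_section_measures:
  assumes [measurable]: "A \<in> sets (M1 \<Otimes>\<^sub>M M2)"
  shows "(\<lambda>\<omega>. \<integral>x. indicator A (\<omega>, x) \<partial>M2 :: real) \<in> borel_measurable M1"
    and "(\<lambda>x. \<integral>\<omega>. indicator A (\<omega>, x) \<partial>M1 :: real) \<in> borel_measurable M2"
  by measurable

text \<open>
  A sharpening of Markov's inequality for random volumes: Markov bounds the probability of
  \<open>S > (\<integral> p) / \<gamma>\<close> by \<open>\<gamma>\<close>, and here the quotient \<open>p / \<gamma>\<close> may be truncated at 1 pointwise,
  under the integral.
\<close>

lemma prob_section_volume_gt_le:
  fixes \<gamma> :: real
  assumes A[measurable]: "A \<in> sets (M1 \<Otimes>\<^sub>M M2)" and "\<gamma> > 0"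
  shows "\<P>(\<omega> in M1. (\<integral>x. indicator A (\<omega>, x) \<partial>M2) >
           (\<integral>x. min 1 ((\<integral>\<omega>. indicator A (\<omega>, x) \<partial>M1) / \<gamma>) \<partial>M2)) \<le> \<gamma>"
proof (rule ccontr)
  define S :: "'a \<Rightarrow> real" where "S \<omega> = (\<integral>x. indicator A (\<omega>, x) \<partial>M2)" for \<omega>
  define p :: "'b \<Rightarrow> real" where "p x = (\<integral>\<omega>. indicator A (\<omega>, x) \<partial>M1)" for x
  define u where "u = (\<integral>x. min 1 (p x / \<gamma>) \<partial>M2)"
  define E where "E = {\<omega> \<in> space M1. S \<omega> > u}"
  define q where "q = M1.prob E"
  have S_meas[measurable]: "S \<in> borel_measurable M1" and p_meas[measurable]: "p \<in> borel_measurable M2"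
    unfolding S_def p_def by (rule borel_measurable_section_measures[OF A])+
  have E[measurable]: "E \<in> sets M1" unfolding E_def by measurable
  assume "\<not> ?thesis"
  then have "q > \<gamma>" by (simp add: q_def E_def S_def u_def p_def not_le)
  with \<open>\<gamma> > 0\<close> have "q > 0" by simp
  have section_int: "integrable M1 (\<lambda>\<omega>. indicator A (\<omega>, x) :: real)" if "x \<in> space M2" for x
    using that by (intro M1.integrable_const_bound[where B=1]) (auto simp: indicator_def)
  have S_nonneg: "0 \<le> S \<omega>" for \<omega>
    unfolding S_def by (intro Bochner_Integration.integral_nonneg) simp
  have S_le: "S \<omega> \<le> 1" if "\<omega> \<in> space M1" for \<omega>
    unfolding S_def using that
    by (intro M2.integral_le_const M2.integrable_const_bound[where B=1]) (auto simp: indicator_def)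
  have p_nonneg: "0 \<le> p x" for x
    unfolding p_def by (intro Bochner_Integration.integral_nonneg) simp
  have S_int: "integrable M1 (\<lambda>\<omega>. indicator E \<omega> * S \<omega>)"
    using S_le S_nonneg by (intro M1.integrable_const_bound[where B=1]) (auto simp: indicator_def)
  have int_min: "integrable M2 (\<lambda>x. min 1 (p x / c))" if "c > 0" for c
    using p_nonneg that by (intro M2.integrable_const_bound[where B=1]) auto
  have prod_int: "integrable (M1 \<Otimes>\<^sub>M M2) (\<lambda>(\<omega>, x). indicator E \<omega> * indicator A (\<omega>, x) :: real)"
    by (intro P.integrable_const_bound[where B=1]) (auto simp: indicator_def)

  have E_cover_le: "(\<integral>\<omega>. indicator E \<omega> * indicator A (\<omega>, x) \<partial>M1) \<le> q * min 1 (p x / q)"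
    (is "?L \<le> _") if x: "x \<in> space M2" for x
  proof -
    have int: "integrable M1 (\<lambda>\<omega>. indicator E \<omega> * indicator A (\<omega>, x) :: real)"
      using x by (intro M1.integrable_const_bound[where B=1]) (auto simp: indicator_def)
    have int_E: "integrable M1 (\<lambda>\<omega>. indicator E \<omega> :: real)"
      by (intro M1.integrable_const_bound[where B=1]) (auto simp: indicator_def)
    have "?L \<le> p x"
      unfolding p_def using section_int[OF x] int
      by (intro integral_mono) (auto simp: indicator_def)
    moreover have "?L \<le> (\<integral>\<omega>. indicator E \<omega> \<partial>M1)"
      using int int_E by (intro integral_mono) (auto simp: indicator_def)
    then have "?L \<le> q" by (simp add: q_def)
    ultimately show ?thesis using \<open>q > 0\<close> by (simp add: min_def field_simps)
  qed

  have "(\<integral>\<omega>. indicator E \<omega> * S \<omega> \<partial>M1) =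
      (\<integral>\<omega>. (\<integral>x. indicator E \<omega> * indicator A (\<omega>, x) \<partial>M2) \<partial>M1)"
    by (simp add: S_def)
  also have "\<dots> = (\<integral>x. (\<integral>\<omega>. indicator E \<omega> * indicator A (\<omega>, x) \<partial>M1) \<partial>M2)"
    by (rule Fubini_integral[symmetric, OF prod_int])
  also have "\<dots> \<le> (\<integral>x. q * min 1 (p x / q) \<partial>M2)"
    using integrable_snd[OF prod_int] int_min[OF \<open>q > 0\<close>] E_cover_le
    by (intro integral_mono) auto
  also have "\<dots> \<le> (\<integral>x. q * min 1 (p x / \<gamma>) \<partial>M2)"
  proof (intro integral_mono integrable_mult_right int_min)
    show "q * min 1 (p x / q) \<le> q * min 1 (p x / \<gamma>)" for x
      using \<open>q > \<gamma>\<close> \<open>\<gamma> > 0\<close> p_nonneg[of x]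
      by (intro mult_left_mono min.mono divide_left_mono) auto
  qed (use \<open>q > 0\<close> \<open>\<gamma> > 0\<close> in auto)
  also have "\<dots> = q * u" by (simp add: u_def)
  also have "\<dots> = (\<integral>\<omega>. indicator E \<omega> * u \<partial>M1)" by (simp add: q_def)
  finally have "(\<integral>\<omega>. indicator E \<omega> * S \<omega> \<partial>M1) \<le> (\<integral>\<omega>. indicator E \<omega> * u \<partial>M1)" .
  moreover have "(\<integral>\<omega>. indicator E \<omega> * u \<partial>M1) < (\<integral>\<omega>. indicator E \<omega> * S \<omega> \<partial>M1)"
  proof (rule M1.integral_less_AE[where A=E])
    show "emeasure M1 E \<noteq> 0"
      using \<open>q > 0\<close> by (simp add: q_def M1.emeasure_eq_measure)
    show "AE \<omega> in M1. \<omega> \<in> E \<longrightarrow> indicator E \<omega> * u \<noteq> indicator E \<omega> * S \<omega>"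
      by (auto simp: E_def)
    show "AE \<omega> in M1. indicator E \<omega> * u \<le> indicator E \<omega> * S \<omega>"
      by (auto simp: E_def indicator_def)
  qed (auto simp: S_int M1.emeasure_eq_measure)
  ultimately show False by simp
qed

end

theorem proposition5p4:
  fixes X :: "(real ^ 'd) set"
    and PX :: "(real ^ 'd) measure"
    and M :: "'w measure"
    and \<xi> :: "real ^ 'd \<Rightarrow> 'w \<Rightarrow> real"
    and T \<alpha> :: real
  assumes "X \<in> sets borel"
    and "prob_space PX" and "sets PX = sets (restrict_space borel X)"
    and "prob_space M"
    and "(\<lambda>(\<omega>, x). \<xi> x \<omega>) \<in> borel_measurable (M \<Otimes>\<^sub>M PX)"
    and "\<alpha> \<in> {0<..<1}"
  shows "\<forall>\<beta>\<in>{0<..<1}.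
    \<P>(\<omega> in M. excursion_volume PX \<xi> T \<omega> \<in> cx_interval M PX \<xi> T \<alpha> \<beta>) \<ge> 1 - \<alpha>"
proof
  fix \<beta> :: real assume \<beta>: "\<beta> \<in> {0<..<1}"
  interpret M: prob_space M by fact
  interpret PX: prob_space PX by fact
  interpret MP: pair_prob_space M PX ..
  define A where "A = {z \<in> space (M \<Otimes>\<^sub>M PX). \<xi> (snd z) (fst z) > T}"
  define B where "B = space (M \<Otimes>\<^sub>M PX) - A"
  define p where "p = excursion_prob M \<xi> T"
  define S where "S = excursion_volume PX \<xi> T"
  define u where "u = (\<integral>x. min 1 (p x / (\<alpha> * (1 - \<beta>))) \<partial>PX)"
  define l where "l = (\<integral>x. min 1 ((1 - p x) / (\<alpha> * \<beta>)) \<partial>PX)"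
  have [measurable]: "(\<lambda>z. \<xi> (snd z) (fst z)) \<in> borel_measurable (M \<Otimes>\<^sub>M PX)"
    using assms(5) by (simp add: case_prod_beta')
  have A[measurable]: "A \<in> sets (M \<Otimes>\<^sub>M PX)" unfolding A_def by measurable
  have B[measurable]: "B \<in> sets (M \<Otimes>\<^sub>M PX)" unfolding B_def by measurable
  have S_A: "S \<omega> = (\<integral>x. indicator A (\<omega>, x) \<partial>PX)" if "\<omega> \<in> space M" for \<omega>
    unfolding S_def excursion_volume_def using that
    by (intro Bochner_Integration.integral_cong) (auto simp: A_def space_pair_measure indicator_def)
  have S_B: "1 - S \<omega> = (\<integral>x. indicator B (\<omega>, x) \<partial>PX)" if \<omega>: "\<omega> \<in> space M" for \<omega>
  proof -
    have "integrable PX (\<lambda>x. indicator A (\<omega>, x) :: real)"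
      using \<omega> by (intro PX.integrable_const_bound[where B=1]) (auto simp: indicator_def)
    then have "1 - S \<omega> = (\<integral>x. 1 - indicator A (\<omega>, x) \<partial>PX)"
      using \<omega> by (simp add: S_A PX.prob_space)
    also have "\<dots> = (\<integral>x. indicator B (\<omega>, x) \<partial>PX)"
      using \<omega> by (intro Bochner_Integration.integral_cong)
        (auto simp: B_def space_pair_measure indicator_def)
    finally show ?thesis .
  qed
  have p_A: "p x = (\<integral>\<omega>. indicator A (\<omega>, x) \<partial>M)" if x: "x \<in> space PX" for x
  proof -
    have "(\<integral>\<omega>. indicator A (\<omega>, x) \<partial>M) = (\<integral>\<omega>. indicator {\<omega> \<in> space M. \<xi> x \<omega> > T} \<omega> \<partial>M :: real)"
      using x by (intro Bochner_Integration.integral_cong)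
        (auto simp: A_def space_pair_measure indicator_def)
    then show ?thesis by (simp add: p_def excursion_prob_def Int_def conj_commute)
  qed
  have p_B: "1 - p x = (\<integral>\<omega>. indicator B (\<omega>, x) \<partial>M)" if x: "x \<in> space PX" for x
  proof -
    have "integrable M (\<lambda>\<omega>. indicator A (\<omega>, x) :: real)"
      using x by (intro M.integrable_const_bound[where B=1]) (auto simp: indicator_def)
    then have "1 - p x = (\<integral>\<omega>. 1 - indicator A (\<omega>, x) \<partial>M)"
      using x by (simp add: p_A M.prob_space)
    also have "\<dots> = (\<integral>\<omega>. indicator B (\<omega>, x) \<partial>M)"
      using x by (intro Bochner_Integration.integral_cong)
        (auto simp: B_def space_pair_measure indicator_def)
    finally show ?thesis .
  qed
  have [measurable]: "S \<in> borel_measurable M"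
    using MP.borel_measurable_section_measures(1)[OF A] by (simp add: S_A cong: measurable_cong)
  define U where "U = {\<omega> \<in> space M. S \<omega> > u}"
  define L where "L = {\<omega> \<in> space M. 1 - S \<omega> > l}"
  have [measurable]: "U \<in> sets M" "L \<in> sets M" unfolding U_def L_def by measurable
  have u_A: "u = (\<integral>x. min 1 ((\<integral>\<omega>. indicator A (\<omega>, x) \<partial>M) / (\<alpha> * (1 - \<beta>))) \<partial>PX)"
    unfolding u_def by (intro Bochner_Integration.integral_cong) (auto simp: p_A)
  have l_B: "l = (\<integral>x. min 1 ((\<integral>\<omega>. indicator B (\<omega>, x) \<partial>M) / (\<alpha> * \<beta>)) \<partial>PX)"
    unfolding l_def by (intro Bochner_Integration.integral_cong) (auto simp: p_B)
  have "M.prob U \<le> \<alpha> * (1 - \<beta>)"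
    using MP.prob_section_volume_gt_le[OF A, of "\<alpha> * (1 - \<beta>)"] assms(6) \<beta>
    unfolding U_def u_A by (simp add: S_A cong: conj_cong)
  moreover have "M.prob L \<le> \<alpha> * \<beta>"
    using MP.prob_section_volume_gt_le[OF B, of "\<alpha> * \<beta>"] assms(6) \<beta>
    unfolding L_def l_B by (simp add: S_B cong: conj_cong)
  moreover have "M.prob (U \<union> L) \<le> M.prob U + M.prob L"
    by (rule measure_Un_le) auto
  ultimately have "M.prob (U \<union> L) \<le> \<alpha>" by (simp add: algebra_simps)
  moreover have "{\<omega> \<in> space M. S \<omega> \<in> {1 - l..u}} = space M - (U \<union> L)"
    by (auto simp: U_def L_def)
  ultimately show "\<P>(\<omega> in M. excursion_volume PX \<xi> T \<omega> \<in> cx_interval M PX \<xi> T \<alpha> \<beta>) \<ge> 1 - \<alpha>"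
    by (simp add: cx_interval_def M.prob_compl flip: S_def p_def u_def l_def)
qed

end
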